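(* Let $\xi=(\xi_1\ge\dots\ge\xi_r\ge 0)$ be a partition and $N$ an integer. The vectors $u_H^{(N)}$, where $H$ runs over the finite subsets $H\subset\mathbb{N}\times\{1,\dots,r\}$ such that $$|H|=|\xi|,\qquad |H\cap(\{1,\dots,k\}\times\{1,\dots,r\})|\ \ge\ \xi^t_1+\dots+\xi^t_k\quad\text{for } k=1,2,\dots,$$ form a basis of $\mathcal{V}(\xi,N)$.
   Context: $\mathbb{N}=\{1,2,\dots\}$. $\mathbb{C}\langle\mathcal{X},\mathcal{Y}\rangle$ is the associative algebra generated by $\mathcal{X},\mathcal{Y}$ with the relation $\mathcal{Y}\mathcal{X}-\mathcal{X}\mathcal{Y}=\mathcal{X}$; it acts on $\mathbb{C}[x,x^{-1}]$ by $\mathcal{X}=x$, $\mathcal{Y}=x\,\partial/\partial x$, preserving each subspace $x^N\mathbb{C}[x]$. $\mathcal{G}_r=\mathfrak{gl}_r\otimes\mathbb{C}\langle\mathcal{X},\mathcal{Y}\rangle$ is the Lie algebra of $r\times r$ matrices over $\mathbb{C}\langle\mathcal{X},\mathcal{Y}\rangle$ with the commutator bracket. $V_r=\mathbb{C}^r$ is the vector representation with standard basis $u_1,\dots,u_r$. For an integer $N$, $V_r^{(N)}=V_r\otimes(\mathbb{C}[x,x^{-1}]/x^N\mathbb{C}[x])$, with basis $u_j^i=u_j\otimes x^i$ ($i<N$, $1\le j\le r$); $\mathcal{G}_r$ acts on $V_r^{(N)}$ and hence on its exterior powers. For a partition $\xi=(\xi_1\ge\dots\ge\xi_r\ge0)$,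 $|\xi|=\sum_j\xi_j$, $\xi^t$ is the transposed partition ($\xi^t_i=\#\{j:\xi_j\ge i\}$), $v_\xi^{(N)}=\bigwedge_{j=1}^r\bigwedge_{i=N-\xi_j}^{N-1}u_j^i\in\bigwedge^{|\xi|}V_r^{(N)}$, and $\mathcal{V}(\xi,N)$ is the $\mathcal{G}_r$-submodule of $\bigwedge^{|\xi|}V_r^{(N)}$ generated by $v_\xi^{(N)}$. For a finite $H\subset\mathbb{N}\times\{1,\dots,r\}$, $u_H^{(N)}=\bigwedge_{(i,j)\in H}u_j^{N-i}\in\bigwedge^{|H|}V_r^{(N)}$ (the factors being taken in some fixed order). *)

theory Defs
  imports "HOL-Analysis.Finite_Cartesian_Product" "HOL-Library.Poly_Mapping"
begin

section \<open>Associative unital complex algebras given by generators and relations\<close>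

datatype 'g aexp = Gen 'g | Const complex | Add "'g aexp" "'g aexp" | Mul "'g aexp" "'g aexp"

inductive alg_cong :: "('g aexp \<Rightarrow> 'g aexp \<Rightarrow> bool) \<Rightarrow> 'g aexp \<Rightarrow> 'g aexp \<Rightarrow> bool"
  for R :: "'g aexp \<Rightarrow> 'g aexp \<Rightarrow> bool" where
  c_base: "R a b \<Longrightarrow> alg_cong R a b"
| c_refl: "alg_cong R a a"
| c_sym: "alg_cong R a b \<Longrightarrow> alg_cong R b a"
| c_trans: "alg_cong R a b \<Longrightarrow> alg_cong R b c \<Longrightarrow> alg_cong R a c"
| c_add_cong: "alg_cong R a a' \<Longrightarrow> alg_cong R b b' \<Longrightarrow> alg_cong R (Add a b) (Add a' b')"
| c_mul_cong: "alg_cong R a a' \<Longrightarrow> alg_cong R b b' \<Longrightarrow> alg_cong R (Mul a b) (Mul a' b')"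
| c_add_assoc: "alg_cong R (Add (Add a b) c) (Add a (Add b c))"
| c_add_comm: "alg_cong R (Add a b) (Add b a)"
| c_zero_add: "alg_cong R (Add (Const 0) a) a"
| c_neg_add: "alg_cong R (Add (Mul (Const (- 1)) a) a) (Const 0)"
| c_mul_assoc: "alg_cong R (Mul (Mul a b) c) (Mul a (Mul b c))"
| c_one_mul: "alg_cong R (Mul (Const 1) a) a"
| c_mul_one: "alg_cong R (Mul a (Const 1)) a"
| c_distrib_right: "alg_cong R (Mul (Add a b) c) (Add (Mul a c) (Mul b c))"
| c_distrib_left: "alg_cong R (Mul a (Add b c)) (Add (Mul a b) (Mul a c))"
| c_const_add: "alg_cong R (Const (x + y)) (Add (Const x) (Const y))"
| c_const_mul: "alg_cong R (Const (x * y)) (Mul (Const x) (Const y))"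
| c_const_comm: "alg_cong R (Mul (Const x) a) (Mul a (Const x))"

fun augment :: "'g aexp \<Rightarrow> complex" where
  "augment (Gen g) = 0"
| "augment (Const c) = c"
| "augment (Add a b) = augment a + augment b"
| "augment (Mul a b) = augment a * augment b"

text \<open>
  The relations are attached to the type of generators. The class assumption says that no
  relation has a constant term; it only serves to make the presented algebra nonzero, as
  required by \<^class>\<open>ring_1\<close>.
\<close>

class presentation =
  fixes relation :: "'a aexp \<Rightarrow> 'a aexp \<Rightarrow> bool"
  assumes augment_relation: "relation a b \<Longrightarrow> augment a = augment b"

lemma augment_cong:
  "alg_cong relation a b \<Longrightarrow> augment a = augment b"
  by (induction rule: alg_cong.induct) (auto simp: augment_relation algebra_simps)

quotient_type (overloaded) 'g palg = "'g::presentation aexp" / "alg_cong relation"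
  by (intro equivpI reflpI sympI transpI)
    (auto intro: alg_cong.c_refl alg_cong.c_sym alg_cong.c_trans)

instantiation palg :: (presentation) ring_1
begin

lift_definition zero_palg :: "'a palg" is "Const 0" .
lift_definition one_palg :: "'a palg" is "Const 1" .
lift_definition plus_palg :: "'a palg \<Rightarrow> 'a palg \<Rightarrow> 'a palg" is Add
  by (rule alg_cong.c_add_cong)
lift_definition times_palg :: "'a palg \<Rightarrow> 'a palg \<Rightarrow> 'a palg" is Mul
  by (rule alg_cong.c_mul_cong)
lift_definition uminus_palg :: "'a palg \<Rightarrow> 'a palg" is "Mul (Const (- 1))"
  by (rule alg_cong.c_mul_cong[OF alg_cong.c_refl])
definition minus_palg :: "'a palg \<Rightarrow> 'a palg \<Rightarrow> 'a palg" where
  "minus_palg a b = a + (- b)"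

instance
proof
  fix a b c :: "'a palg"
  show "a + b + c = a + (b + c)" by transfer (rule alg_cong.c_add_assoc)
  show "a + b = b + a" by transfer (rule alg_cong.c_add_comm)
  show "0 + a = a" by transfer (rule alg_cong.c_zero_add)
  show "- a + a = 0" by transfer (rule alg_cong.c_neg_add)
  show "a - b = a + - b" by (rule minus_palg_def)
  show "a * b * c = a * (b * c)" by transfer (rule alg_cong.c_mul_assoc)
  show "1 * a = a" by transfer (rule alg_cong.c_one_mul)
  show "a * 1 = a" by transfer (rule alg_cong.c_mul_one)
  show "(a + b) * c = a * c + b * c" by transfer (rule alg_cong.c_distrib_right)
  show "a * (b + c) = a * b + a * c" by transfer (rule alg_cong.c_distrib_left)
  show "(0::'a palg) \<noteq> 1" by transfer (auto dest: augment_cong)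
qed

end

lift_definition pgen :: "'g \<Rightarrow> 'g::presentation palg" is Gen .
lift_definition pconst :: "complex \<Rightarrow> 'g::presentation palg" is Const .

definition pscale :: "complex \<Rightarrow> 'g::presentation palg \<Rightarrow> 'g palg" where
  "pscale c a = pconst c * a"

lemma pconst_add: "pconst (x + y) = pconst x + pconst y"
  by transfer (rule alg_cong.c_const_add)

lemma pconst_mult: "pconst (x * y) = pconst x * pconst y"
  by transfer (rule alg_cong.c_const_mul)

lemma pconst_one: "pconst 1 = 1"
  by transfer (rule alg_cong.c_refl)

lemma pconst_zero: "pconst 0 = 0"
  by transfer (rule alg_cong.c_refl)

lemma pconst_commute: "pconst x * a = a * pconst x"
  by transfer (rule alg_cong.c_const_comm)

global_interpretation palg: vector_space "pscale :: complex \<Rightarrow> 'g::presentation palg \<Rightarrow> 'g palg"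
  by unfold_locales
    (auto simp: pscale_def pconst_add pconst_mult pconst_one algebra_simps)

section \<open>The algebra generated by X and Y with YX - XY = X, acting on Laurent polynomials\<close>

datatype weyl_gen = GenX | GenY

instantiation weyl_gen :: presentation
begin

inductive relation_weyl_gen :: "weyl_gen aexp \<Rightarrow> weyl_gen aexp \<Rightarrow> bool" where
  "relation_weyl_gen (Mul (Gen GenY) (Gen GenX)) (Add (Mul (Gen GenX) (Gen GenY)) (Gen GenX))"

instance
  by standard (auto elim: relation_weyl_gen.cases)

end

type_synonym weyl = "weyl_gen palg"

lemma weyl_relation: "pgen GenY * pgen GenX - pgen GenX * pgen GenY = (pgen GenX :: weyl)"
proof -
  have "pgen GenY * pgen GenX = pgen GenX * pgen GenY + (pgen GenX :: weyl)"
    by transfer (intro alg_cong.c_base relation_weyl_gen.intros)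
  thus ?thesis by simp
qed

type_synonym laurent = "int \<Rightarrow>\<^sub>0 complex"

definition xpow :: "int \<Rightarrow> laurent" where
  "xpow i = Poly_Mapping.single i 1"

definition lconst :: "complex \<Rightarrow> laurent" where
  "lconst c = Poly_Mapping.single 0 c"

definition euler :: "laurent \<Rightarrow> laurent" where
  "euler f = Poly_Mapping.mapp (\<lambda>i c. of_int i * c) f"

lemma lookup_euler: "Poly_Mapping.lookup (euler f) i = of_int i * Poly_Mapping.lookup f i"
  by (auto simp: euler_def lookup_mapp when_def in_keys_iff)

lemma euler_single:
  "euler (Poly_Mapping.single i c) = Poly_Mapping.single i (of_int i * c)"
  by (rule poly_mapping_eqI) (auto simp: lookup_euler lookup_single when_def)

lemma euler_add: "euler (f + g) = euler f + euler g"
  by (rule poly_mapping_eqI) (auto simp: lookup_euler lookup_add algebra_simps)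

lemma euler_zero: "euler 0 = 0"
  by (rule poly_mapping_eqI) (auto simp: lookup_euler)

lemma laurent_induct [case_names zero single_add]:
  fixes f :: laurent
  assumes zero: "P 0" and step: "\<And>i c g. P g \<Longrightarrow> P (Poly_Mapping.single i c + g)"
  shows "P f"
proof (induction f rule: update_induct)
  case const
  show ?case by (rule zero)
next
  case (update f a b)
  have "Poly_Mapping.update a b f = Poly_Mapping.single a b + f"
    using update by (intro poly_mapping_eqI)
      (auto simp: lookup_update lookup_add lookup_single when_def in_keys_iff)
  thus ?case using step update by simp
qed

lemma euler_lconst: "euler (lconst c * f) = lconst c * euler f"
  by (induction f rule: laurent_induct)
    (auto simp: euler_zero euler_add euler_single lconst_def mult_single algebra_simps)

lemma euler_xpow: "euler (xpow 1 * f) = xpow 1 * euler f + xpow 1 * f"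
  by (induction f rule: laurent_induct)
    (auto simp: euler_zero euler_add euler_single xpow_def mult_single algebra_simps single_add)

primrec weyl_act_exp :: "weyl_gen aexp \<Rightarrow> laurent \<Rightarrow> laurent" where
  "weyl_act_exp (Gen g) f = (case g of GenX \<Rightarrow> xpow 1 * f | GenY \<Rightarrow> euler f)"
| "weyl_act_exp (Const c) f = lconst c * f"
| "weyl_act_exp (Add a b) f = weyl_act_exp a f + weyl_act_exp b f"
| "weyl_act_exp (Mul a b) f = weyl_act_exp a (weyl_act_exp b f)"

lemma lconst_simps:
  "lconst (x + y) = lconst x + lconst y" "lconst (x * y) = lconst x * lconst y"
  "lconst 0 = 0" "lconst 1 = 1"
  by (simp_all add: lconst_def single_add mult_single)

lemma weyl_act_exp_add: "weyl_act_exp a (f + g) = weyl_act_exp a f + weyl_act_exp a g"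
  by (induction a arbitrary: f g)
    (auto simp: algebra_simps euler_add split: weyl_gen.splits)

lemma weyl_act_exp_scale: "weyl_act_exp a (lconst c * f) = lconst c * weyl_act_exp a f"
proof (induction a arbitrary: f)
  case (Gen g)
  show ?case by (cases g) (simp_all add: euler_lconst mult.left_commute)
qed (simp_all add: distrib_left mult.left_commute)

lemma weyl_act_exp_cong:
  "alg_cong relation a b \<Longrightarrow> weyl_act_exp a = weyl_act_exp b"
proof (induction rule: alg_cong.induct)
  case (c_base a b)
  thus ?case by cases (auto simp: fun_eq_iff euler_xpow)
next
  case (c_neg_add a)
  have "lconst (- 1) = - 1"
    using lconst_simps(1)[of "- 1" 1] by (simp add: lconst_simps eq_neg_iff_add_eq_0)
  thus ?case by (auto simp: fun_eq_iff lconst_simps)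
qed (auto simp: fun_eq_iff weyl_act_exp_add weyl_act_exp_scale lconst_simps add_ac mult.assoc
      distrib_right)

lift_definition weyl_act :: "weyl \<Rightarrow> laurent \<Rightarrow> laurent" is weyl_act_exp
  by (rule weyl_act_exp_cong)

lemma weyl_act_X: "weyl_act (pgen GenX) f = xpow 1 * f"
  by transfer simp

lemma weyl_act_Y: "weyl_act (pgen GenY) f = euler f"
  by transfer simp

lemma weyl_act_const: "weyl_act (pconst c) f = lconst c * f"
  by transfer simp

lemma weyl_act_plus: "weyl_act (a + b) f = weyl_act a f + weyl_act b f"
  by transfer simp

lemma weyl_act_times: "weyl_act (a * b) f = weyl_act a (weyl_act b f)"
  by transfer simp

lemma weyl_act_add: "weyl_act a (f + g) = weyl_act a f + weyl_act a g"
  by transfer (rule weyl_act_exp_add)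

lemma weyl_act_scale: "weyl_act a (lconst c * f) = lconst c * weyl_act a f"
  by transfer (rule weyl_act_exp_scale)

lemma weyl_act_zero: "weyl_act a 0 = 0"
  using weyl_act_add[of a 0 0] by simp

lemma weyl_act_zero_left: "weyl_act 0 f = 0"
  using weyl_act_plus[of 0 0 f] by simp

lemma weyl_act_minus: "weyl_act (a - b) f = weyl_act a f - weyl_act b f"
  using weyl_act_plus[of "a - b" b f] by (simp add: algebra_simps)

lemma weyl_act_sum: "weyl_act a (\<Sum>i\<in>I. f i) = (\<Sum>i\<in>I. weyl_act a (f i))"
  by (induction I rule: infinite_finite_induct) (auto simp: weyl_act_zero weyl_act_add)

lemma weyl_act_sum_left: "weyl_act (\<Sum>i\<in>I. a i) f = (\<Sum>i\<in>I. weyl_act (a i) f)"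
  by (induction I rule: infinite_finite_induct) (auto simp: weyl_act_zero_left weyl_act_plus)

section \<open>Matrices and their action on the truncated vector representation\<close>

text \<open>
  The index set \<open>{1, \<dots>, r}\<close> is rendered by a finite linearly ordered type \<open>'r\<close>, and
  \<open>gl\<^sub>r \<otimes> A\<close>, \<open>V\<^sub>r \<otimes> M\<close> by matrices and vectors with entries in \<open>A\<close>, \<open>M\<close>.
\<close>

type_synonym 'r gl_weyl = "weyl ^ 'r ^ 'r"
type_synonym 'r lvec = "laurent ^ 'r"

definition bracket :: "'r::finite gl_weyl \<Rightarrow> 'r gl_weyl \<Rightarrow> 'r gl_weyl" where
  "bracket A B = A ** B - B ** A"

definition gl_act :: "'r::finite gl_weyl \<Rightarrow> 'r lvec \<Rightarrow> 'r lvec" where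
  "gl_act A v = (\<chi> i. \<Sum>j\<in>UNIV. weyl_act (A $ i $ j) (v $ j))"

text \<open>
  The quotient of the Laurent polynomials by \<open>x\<^sup>N \<complex>[x]\<close> is represented by the complement with
  basis \<open>x\<^sup>i\<close>, \<open>i < N\<close>, the quotient map being \<open>below N\<close>: it has kernel
  \<open>x\<^sup>N \<complex>[x]\<close> (\<open>below_eq_0_iff\<close>), and since that subspace is preserved, \<open>VN_act\<close> is the
  induced action (\<open>vbelow_gl_act\<close>).
\<close>

definition below :: "int \<Rightarrow> laurent \<Rightarrow> laurent" where
  "below N f = Poly_Mapping.mapp (\<lambda>i c. c when i < N) f"

definition vbelow :: "int \<Rightarrow> 'r::finite lvec \<Rightarrow> 'r lvec" where
  "vbelow N v = (\<chi> j. below N (v $ j))"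

definition VN :: "int \<Rightarrow> 'r::finite lvec set" where
  "VN N = {v. \<forall>j. Poly_Mapping.keys (v $ j) \<subseteq> {..<N}}"

definition VN_act :: "int \<Rightarrow> 'r::finite gl_weyl \<Rightarrow> 'r lvec \<Rightarrow> 'r lvec" where
  "VN_act N A v = vbelow N (gl_act A v)"

definition uvec :: "'r::finite \<Rightarrow> int \<Rightarrow> 'r lvec" where
  "uvec j i = axis j (xpow i)"

lemma lookup_below:
  "Poly_Mapping.lookup (below N f) i = (if i < N then Poly_Mapping.lookup f i else 0)"
  by (auto simp: below_def lookup_mapp when_def in_keys_iff)

lemma below_add: "below N (f + g) = below N f + below N g"
  by (rule poly_mapping_eqI) (simp add: lookup_below lookup_add)

lemma below_minus: "below N (f - g) = below N f - below N g"
  by (rule poly_mapping_eqI) (simp add: lookup_below lookup_minus)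

lemma below_zero: "below N 0 = 0"
  by (rule poly_mapping_eqI) (simp add: lookup_below)

lemma below_single:
  "below N (Poly_Mapping.single i c) = (if i < N then Poly_Mapping.single i c else 0)"
  by (rule poly_mapping_eqI) (auto simp: lookup_below lookup_single when_def)

lemma below_scale: "below N (lconst c * f) = lconst c * below N f"
  by (induction f rule: laurent_induct)
    (auto simp: below_zero below_add below_single lconst_def mult_single algebra_simps)

lemma below_eq_0_iff: "below N f = 0 \<longleftrightarrow> Poly_Mapping.keys f \<subseteq> {N..}"
proof -
  have "below N f = 0 \<longleftrightarrow> (\<forall>i. i < N \<longrightarrow> Poly_Mapping.lookup f i = 0)"
    by (auto simp: poly_mapping_eq_iff fun_eq_iff lookup_below)
  also have "\<dots> \<longleftrightarrow> Poly_Mapping.keys f \<subseteq> {N..}"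
    by (auto simp: subset_iff in_keys_iff) (meson not_less)
  finally show ?thesis .
qed

lemma below_sum: "below N (\<Sum>i\<in>I. f i) = (\<Sum>i\<in>I. below N (f i))"
  by (induction I rule: infinite_finite_induct) (auto simp: below_zero below_add)

lemma below_xpow: "below N (xpow 1 * below N f) = below N (xpow 1 * f)"
  by (induction f rule: laurent_induct)
    (auto simp: below_zero below_add below_single xpow_def mult_single algebra_simps)

lemma below_euler: "below N (euler (below N f)) = below N (euler f)"
  by (rule poly_mapping_eqI) (auto simp: lookup_below lookup_euler)

lemma below_idem: "below N (below N f) = below N f"
  by (rule poly_mapping_eqI) (auto simp: lookup_below)

lemma below_weyl_act_exp: "below N (weyl_act_exp a (below N f)) = below N (weyl_act_exp a f)"
proof (induction a arbitrary: f)
  case (Gen g)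
  thus ?case by (cases g) (auto simp: below_xpow below_euler)
next
  case (Mul a b)
  show ?case by (metis Mul weyl_act_exp.simps(4))
qed (auto simp: below_scale below_add below_idem)

lemma below_weyl_act: "below N (weyl_act a (below N f)) = below N (weyl_act a f)"
  by transfer (rule below_weyl_act_exp)

lemma gl_act_bracket:
  "gl_act (bracket A B) v = gl_act A (gl_act B v) - gl_act B (gl_act A v)"
proof -
  have *: "(\<Sum>j\<in>UNIV. \<Sum>k\<in>UNIV. weyl_act (P $ i $ k) (weyl_act (Q $ k $ j) (v $ j)))
      = (\<Sum>k\<in>UNIV. weyl_act (P $ i $ k) (\<Sum>j\<in>UNIV. weyl_act (Q $ k $ j) (v $ j)))"
    for P Q :: "'a gl_weyl" and i
    by (subst sum.swap) (simp add: weyl_act_sum)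
  show ?thesis
    by (simp add: vec_eq_iff gl_act_def bracket_def matrix_matrix_mult_def weyl_act_minus
        sum_subtractf weyl_act_sum_left weyl_act_times *)
qed

lemma vbelow_gl_act: "vbelow N (gl_act A (vbelow N v)) = vbelow N (gl_act A v)"
  by (simp add: vec_eq_iff vbelow_def gl_act_def below_sum below_weyl_act)

lemma VN_act_bracket:
  "VN_act N (bracket A B) v = VN_act N A (VN_act N B v) - VN_act N B (VN_act N A v)"
  unfolding VN_act_def vbelow_gl_act
  by (simp add: gl_act_bracket vec_eq_iff vbelow_def below_minus)

lemma VN_act_in_VN: "VN_act N A v \<in> VN N"
  by (auto simp: VN_def VN_act_def vbelow_def lookup_below in_keys_iff split: if_splits)

lemma VN_act_add: "VN_act N A (v + w) = VN_act N A v + VN_act N A w"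
  by (simp add: vec_eq_iff VN_act_def vbelow_def gl_act_def below_add below_sum weyl_act_add
      sum.distrib)

lemma VN_act_scale: "VN_act N A (lconst c *s v) = lconst c *s VN_act N A v"
  by (simp add: vec_eq_iff VN_act_def vbelow_def gl_act_def below_sum weyl_act_scale below_scale
      sum_distrib_left)

section \<open>The exterior algebra\<close>

text \<open>
  The exterior algebra of \<open>V\<^sub>r \<otimes> \<complex>[x, x\<^sup>-\<^sup>1]\<close>: the algebra generated by the
  vectors, subject to linearity and \<open>v \<and> v = 0\<close>. Over a field, the exterior powers of the
  subspace \<open>VN N\<close> embed in it, and they are formed there.
\<close>

datatype 'r ext_gen = Vec "'r::finite lvec"

instantiation ext_gen :: (finite) presentation
begin

inductive relation_ext_gen :: "'a ext_gen aexp \<Rightarrow> 'a ext_gen aexp \<Rightarrow> bool" where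
  "relation_ext_gen (Gen (Vec (v + w))) (Add (Gen (Vec v)) (Gen (Vec w)))"
| "relation_ext_gen (Gen (Vec (lconst c *s v))) (Mul (Const c) (Gen (Vec v)))"
| "relation_ext_gen (Mul (Gen (Vec v)) (Gen (Vec v))) (Const 0)"

instance
  by standard (auto elim: relation_ext_gen.cases)

end

type_synonym 'r ext = "'r ext_gen palg"

definition wedge :: "'r::finite lvec list \<Rightarrow> 'r ext" where
  "wedge vs = prod_list (map (\<lambda>v. pgen (Vec v)) vs)"

definition ext_power :: "int \<Rightarrow> nat \<Rightarrow> 'r::finite ext set" where
  "ext_power N n = palg.span {wedge vs | vs. length vs = n \<and> set vs \<subseteq> VN N}"

text \<open>The action on exterior powers is by the derivation extending the action on vectors.\<close>

primrec derivation :: "('r::finite lvec \<Rightarrow> 'r lvec) \<Rightarrow> 'r ext_gen aexp \<Rightarrow> 'r ext_gen aexp" where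
  "derivation d (Gen g) = (case g of Vec v \<Rightarrow> Gen (Vec (d v)))"
| "derivation d (Const c) = Const 0"
| "derivation d (Add a b) = Add (derivation d a) (derivation d b)"
| "derivation d (Mul a b) = Add (Mul (derivation d a) b) (Mul a (derivation d b))"

abbreviation toE :: "'r::finite ext_gen aexp \<Rightarrow> 'r ext" where
  "toE \<equiv> abs_palg"

lemma toE_simps:
  "toE (Add a b) = toE a + toE b" "toE (Mul a b) = toE a * toE b"
  "toE (Const c) = pconst c" "toE (Gen g) = pgen g"
  by (simp_all add: plus_palg.abs_eq times_palg.abs_eq pconst.abs_eq pgen.abs_eq)

lemma toE_eq_iff: "toE a = toE b \<longleftrightarrow> alg_cong relation a b"
  by (rule palg.abs_eq_iff)

lemma vec_plus: "(pgen (Vec (v + w)) :: 'r::finite ext) = pgen (Vec v) + pgen (Vec w)"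
  by transfer (intro alg_cong.c_base relation_ext_gen.intros)

lemma vec_scale: "(pgen (Vec (lconst c *s v)) :: 'r::finite ext) = pconst c * pgen (Vec v)"
  by transfer (intro alg_cong.c_base relation_ext_gen.intros)

lemma vec_square: "pgen (Vec v) * pgen (Vec v) = (0 :: 'r::finite ext)"
  by transfer (intro alg_cong.c_base relation_ext_gen.intros)

lemma vec_anticommute:
  "pgen (Vec v) * pgen (Vec w) + pgen (Vec w) * pgen (Vec v) = (0 :: 'r::finite ext)"
  using vec_square[of "v + w"] by (simp add: vec_plus vec_square algebra_simps)

lemma pconst_mult_left_commute:
  "b * (pconst c * a) = pconst c * (b * (a :: 'g::presentation palg))"
  by (metis mult.assoc pconst_commute)

lemma derivation_cong:
  assumes add: "\<And>v w. d (v + w) = d v + d w"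
    and scale: "\<And>c v. d (lconst c *s v) = lconst c *s d v"
    and "alg_cong relation a b"
  shows "alg_cong relation (derivation d a) (derivation d b)"
  using assms(3)
proof (induction rule: alg_cong.induct)
  case (c_base a b)
  thus ?case
    by cases (auto simp: add scale vec_plus vec_scale vec_anticommute pconst_zero
        toE_simps simp flip: toE_eq_iff)
next
  case (c_neg_add a)
  have "pconst (- 1) * x + x = (0 :: 'a ext)" for x
    by transfer (rule alg_cong.c_neg_add)
  thus ?case by (simp add: toE_simps pconst_zero flip: toE_eq_iff)
next
  case (c_const_comm x a)
  show ?case by (simp add: toE_simps pconst_zero pconst_commute flip: toE_eq_iff)
qed (simp_all add: toE_simps pconst_zero pconst_one pconst_add pconst_mult algebra_simps
      flip: toE_eq_iff)

lift_definition ext_act :: "int \<Rightarrow> 'r::finite gl_weyl \<Rightarrow> 'r ext \<Rightarrow> 'r ext" is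
  "\<lambda>N A. derivation (VN_act N A)"
  by (rule derivation_cong[OF VN_act_add VN_act_scale])

lemma ext_act_vec: "ext_act N A (pgen (Vec v)) = pgen (Vec (VN_act N A v))"
  by transfer (simp add: alg_cong.c_refl)

lemma ext_act_const: "ext_act N A (pconst c) = 0"
  by transfer (simp add: alg_cong.c_refl)

lemma ext_act_plus: "ext_act N A (a + b) = ext_act N A a + ext_act N A b"
  by transfer (simp add: alg_cong.c_refl)

lemma ext_act_times: "ext_act N A (a * b) = ext_act N A a * b + a * ext_act N A b"
  by transfer (simp add: alg_cong.c_refl)

lemma pgen_vec_minus: "pgen (Vec (v - w)) = (pgen (Vec v) - pgen (Vec w) :: 'r::finite ext)"
  using vec_plus[of "v - w" w] by (simp add: algebra_simps)

lemma ext_act_bracket: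
  "ext_act N (bracket A B) w = ext_act N A (ext_act N B w) - ext_act N B (ext_act N A w)"
proof -
  obtain e where e: "w = toE e"
    by (metis Quotient_abs_rep[OF Quotient_palg])
  have "ext_act N (bracket A B) (toE e)
      = ext_act N A (ext_act N B (toE e)) - ext_act N B (ext_act N A (toE e))"
  proof (induction e)
    case (Gen g)
    show ?case
      by (cases g) (simp add: toE_simps ext_act_vec VN_act_bracket pgen_vec_minus)
  next
    case (Const c)
    show ?case
      by (simp add: toE_simps ext_act_const flip: pconst_zero)
  next
    case (Add a b)
    thus ?case by (simp add: toE_simps ext_act_plus)
  next
    case (Mul a b)
    show ?case by (simp add: toE_simps ext_act_plus ext_act_times Mul algebra_simps)
  qed
  with e show ?thesis by simp
qed

section \<open>The modules generated by the vectors of a partition\<close>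

definition partition_size :: "('r::finite \<Rightarrow> nat) \<Rightarrow> nat" where
  "partition_size \<xi> = (\<Sum>j\<in>UNIV. \<xi> j)"

definition transposed :: "('r::finite \<Rightarrow> nat) \<Rightarrow> nat \<Rightarrow> nat" where
  "transposed \<xi> i = card {j. \<xi> j \<ge> i}"

definition v_part :: "('r::{finite,linorder} \<Rightarrow> nat) \<Rightarrow> int \<Rightarrow> 'r ext" where
  "v_part \<xi> N =
    wedge (concat (map (\<lambda>j. map (uvec j) [N - int (\<xi> j)..N - 1]) (sorted_list_of_set UNIV)))"

definition is_submodule :: "int \<Rightarrow> nat \<Rightarrow> 'r::finite ext set \<Rightarrow> bool" where
  "is_submodule N n W \<longleftrightarrow>
    palg.subspace W \<and> W \<subseteq> ext_power N n \<and> (\<forall>A. \<forall>w\<in>W. ext_act N A w \<in> W)"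

lemma ext_act_scale: "ext_act N A (pscale c w) = pscale c (ext_act N A w)"
  by (simp add: pscale_def ext_act_times ext_act_const)

lemma ext_act_wedge:
  "ext_act N A (wedge vs) = (\<Sum>i<length vs. wedge (vs[i := VN_act N A (vs ! i)]))"
proof (induction vs)
  case Nil
  show ?case
    using ext_act_const[of N A 1] by (simp add: wedge_def pconst_one)
next
  case (Cons v vs)
  have *: "wedge (x # xs) = pgen (Vec x) * wedge xs" for x :: "'a lvec" and xs
    by (simp add: wedge_def)
  show ?case
    by (simp add: * ext_act_times ext_act_vec Cons sum.lessThan_Suc_shift sum_distrib_left
        del: sum.lessThan_Suc)
qed

lemma ext_power_submodule: "is_submodule N n (ext_power N n)"
  unfolding is_submodule_def
proof (intro conjI allI ballI)
  show "palg.subspace (ext_power N n)"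
    unfolding ext_power_def by (rule palg.subspace_span)
  fix A and w :: "'a ext"
  assume "w \<in> ext_power N n"
  thus "ext_act N A w \<in> ext_power N n"
    unfolding ext_power_def
  proof (induction rule: palg.span_induct_alt)
    case base
    show ?case
      using ext_act_const[of N A 0] by (simp add: pconst_zero palg.span_zero)
  next
    case (step c x y)
    then obtain vs where vs: "x = wedge vs" "length vs = n" "set vs \<subseteq> VN N"
      by auto
    have "wedge (vs[i := VN_act N A (vs ! i)])
        \<in> palg.span {wedge vs | vs. length vs = n \<and> set vs \<subseteq> VN N}" for i
      using vs set_update_subset_insert[of vs i "VN_act N A (vs ! i)"] VN_act_in_VN[of N A]
      by (intro palg.span_base) (auto intro!: exI[of _ "vs[i := VN_act N A (vs ! i)]"])
    thus ?case
      using step unfolding vs(1)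
      by (auto simp: ext_act_plus ext_act_scale ext_act_wedge
          intro!: palg.span_add palg.span_scale palg.span_sum)
  qed
qed simp

lemma v_part_in_ext_power: "v_part \<xi> N \<in> ext_power N (partition_size \<xi>)"
  unfolding v_part_def ext_power_def
proof (intro palg.span_base CollectI exI conjI)
  let ?vs = "concat (map (\<lambda>j. map (uvec j) [N - int (\<xi> j)..N - 1]) (sorted_list_of_set UNIV))"
  show "length ?vs = partition_size \<xi>"
    by (simp add: length_concat comp_def partition_size_def sum_list_distinct_conv_sum_set)
  show "set ?vs \<subseteq> VN N"
    by (auto simp: VN_def uvec_def axis_def xpow_def split: if_splits)
qed (rule HOL.refl)

definition V_mod :: "('r::{finite,linorder} \<Rightarrow> nat) \<Rightarrow> int \<Rightarrow> 'r ext set" where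
  "V_mod \<xi> N = \<Inter>{W. is_submodule N (partition_size \<xi>) W \<and> v_part \<xi> N \<in> W}"

text \<open>
  \<open>enum\<close> chooses the order of the factors; changing it affects \<open>u_set\<close> only by a sign.
\<close>

definition u_set :: "((nat \<times> 'r) set \<Rightarrow> (nat \<times> 'r) list) \<Rightarrow> int \<Rightarrow> (nat \<times> 'r::finite) set \<Rightarrow> 'r ext" where
  "u_set enum N H = wedge (map (\<lambda>(i, j). uvec j (N - int i)) (enum H))"

definition admissible :: "('r::finite \<Rightarrow> nat) \<Rightarrow> (nat \<times> 'r) set set" where
  "admissible \<xi> = {H. finite H \<and> H \<subseteq> {1..} \<times> UNIV \<and> card H = partition_size \<xi> \<and>
    (\<forall>k\<ge>1. card (H \<inter> ({1..k} \<times> UNIV)) \<ge> (\<Sum>i=1..k. transposed \<xi> i))}"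

end

theory Submission
  imports Defs "HOL-Library.Multiset"
begin

text \<open>
  Give the basis vector \<open>u\<^sub>j x\<^sup>N\<^sup>-\<^sup>i\<close> the depth \<open>i \<ge> 1\<close>, and
  call a wedge of such vectors a wedge of the set of its indices \<open>(i, j)\<close>. The generator
  \<open>\<X> = x\<close> lowers depth by one (and kills depth 1), while \<open>\<Y>\<close> acts on
  \<open>x\<^sup>m\<close> by the scalar \<open>m\<close>. So no element of the Lie algebra can increase a depth,
  and, since polynomials in \<open>\<Y>\<close> interpolate any values at finitely many exponents, every
  replacement of one index \<open>(i, b)\<close> by one index \<open>(i', a)\<close> with \<open>1 \<le> i' \<le> i\<close> is
  achieved on a given wedge by some matrix with a single entry \<open>\<X>\<^sup>n p(\<Y>)\<close>. The
  module generated by \<open>v\<^sub>\<xi>\<close> is therefore governed by a combinatorial question: which sets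
  arise from the Young diagram of \<open>\<xi>\<close> by such exchanges?

  The condition in the theorem says that, for each \<open>k\<close>, the set has at least as many elements
  of depth at most \<open>k\<close> as the Young diagram; call such sets dominating. An exchange can only
  increase these counts, so the wedges of dominating sets span a submodule
  (\<open>span_dominating_submodule\<close>). Conversely, if \<open>H\<close> dominates \<open>S \<noteq> H\<close>, let \<open>x\<close>
  and \<open>y\<close> be elements of least depth in \<open>S - H\<close> and in \<open>H - S\<close>; then exchanging
  \<open>x\<close> for \<open>y\<close> is a permitted move, the result is still dominated by \<open>H\<close>, and it is
  closer to \<open>H\<close>. Hence every submodule containing the wedge of \<open>S\<close> contains the wedge of
  \<open>H\<close> (\<open>submodule_dominating\<close>).

  Linear independence is a fact about the exterior algebra alone, which here is given by generators
  and relations. Contracting successively with the coordinates indexed by \<open>G\<close> and then taking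
  the constant term is a linear functional which is nonzero on the wedge of \<open>G\<close> and zero on the
  wedge of any other set of the same size (\<open>augmentation_contract_list\<close>).
\<close>

section \<open>Contractions on the exterior algebra\<close>

lemma pconst_minus_one: "pconst (- 1) * a = - (a :: 'g::presentation palg)"
  by transfer (rule alg_cong.c_refl)

text \<open>
  The automorphism that is \<open>(-1)\<^sup>n\<close> in degree \<open>n\<close>. It supplies the signs in the
  antiderivation below, whose product rule would otherwise be incompatible with
  \<open>v \<and> v = 0\<close>.
\<close>

primrec grade_exp :: "'r::finite ext_gen aexp \<Rightarrow> 'r ext_gen aexp" where
  "grade_exp (Gen g) = Mul (Const (- 1)) (Gen g)"
| "grade_exp (Const c) = Const c"
| "grade_exp (Add a b) = Add (grade_exp a) (grade_exp b)"
| "grade_exp (Mul a b) = Mul (grade_exp a) (grade_exp b)"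

text \<open>
  The antiderivation (interior product) that extends a linear form \<open>\<phi>\<close> on vectors.
\<close>

primrec contract_exp ::
  "('r::finite lvec \<Rightarrow> complex) \<Rightarrow> 'r ext_gen aexp \<Rightarrow> 'r ext_gen aexp" where
  "contract_exp \<phi> (Gen g) = (case g of Vec v \<Rightarrow> Const (\<phi> v))"
| "contract_exp \<phi> (Const c) = Const 0"
| "contract_exp \<phi> (Add a b) = Add (contract_exp \<phi> a) (contract_exp \<phi> b)"
| "contract_exp \<phi> (Mul a b) =
    Add (Mul (contract_exp \<phi> a) b) (Mul (grade_exp a) (contract_exp \<phi> b))"

lemma grade_exp_cong:
  "alg_cong relation a b \<Longrightarrow> toE (grade_exp a) = toE (grade_exp b)"
proof (induction rule: alg_cong.induct)
  case (c_base a b)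
  thus ?case
    by cases (auto simp: toE_simps vec_plus vec_scale vec_square pconst_zero pconst_minus_one
        algebra_simps)
next
  case (c_const_comm x a)
  show ?case by (simp add: toE_simps pconst_commute)
qed (simp_all add: toE_simps pconst_zero pconst_one pconst_add pconst_mult pconst_minus_one
      algebra_simps)

text \<open>
  The only relation for which the sign matters is \<open>v \<and> v = 0\<close>: its left side is sent to
  \<open>\<phi>(v) v - v \<phi>(v)\<close>, which vanishes because constants are central.
\<close>

lemma contract_exp_cong:
  assumes add: "\<And>v w. \<phi> (v + w) = \<phi> v + \<phi> w"
    and scale: "\<And>c v. \<phi> (lconst c *s v) = c * \<phi> v"
    and "alg_cong relation a b"
  shows "alg_cong relation (contract_exp \<phi> a) (contract_exp \<phi> b)"
  unfolding toE_eq_iff[symmetric] using assms(3)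
proof (induction rule: alg_cong.induct)
  case (c_base a b)
  thus ?case
    by cases (auto simp: toE_simps add scale pconst_zero pconst_add pconst_mult pconst_minus_one
        pconst_commute[of "\<phi> v" "pgen (Vec v)" for v])
next
  case (c_const_comm x a)
  show ?case
    using pconst_commute[of x "toE (contract_exp \<phi> a)"] by (simp add: toE_simps pconst_zero)
next
  case (c_mul_cong a a' b b')
  thus ?case using grade_exp_cong[of a a'] by (simp add: toE_simps flip: toE_eq_iff)
qed (simp_all add: toE_simps pconst_zero pconst_one pconst_add pconst_mult pconst_minus_one
      algebra_simps)

text \<open>
  Contraction with the coordinate form of \<open>u\<^sub>j x\<^sup>m\<close>.
\<close>

lift_definition contract :: "int \<Rightarrow> 'r::finite \<Rightarrow> 'r ext \<Rightarrow> 'r ext" is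
  "\<lambda>m j. contract_exp (\<lambda>v. Poly_Mapping.lookup (v $ j) m)"
proof (rule contract_exp_cong)
  fix m :: int and j :: 'r and c and v :: "'r lvec"
  have "Poly_Mapping.lookup (lconst c * f) m = c * Poly_Mapping.lookup f m" for f
    by (induction f rule: laurent_induct)
      (auto simp: lconst_def mult_single lookup_add lookup_single when_def algebra_simps)
  thus "Poly_Mapping.lookup ((lconst c *s v) $ j) m = c * Poly_Mapping.lookup (v $ j) m"
    by simp
qed (simp_all add: lookup_add)

lemma contract_plus: "contract m j (a + b) = contract m j a + contract m j b"
  by transfer (simp add: alg_cong.c_refl)

lemma contract_scale: "contract m j (pscale c a) = pscale c (contract m j a)"
proof -
  let ?\<phi> = "\<lambda>v. Poly_Mapping.lookup (v $ j) m"
  obtain e where e: "a = toE e"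
    by (metis Quotient_abs_rep[OF Quotient_palg])
  have "contract m j (toE (Mul (Const c) e)) = toE (contract_exp ?\<phi> (Mul (Const c) e))"
    by (simp only: contract.abs_eq)
  thus ?thesis
    by (simp add: toE_simps e pscale_def pconst_zero contract.abs_eq)
qed

lemma contract_wedge_Cons:
  "contract m j (wedge (v # vs))
    = pconst (Poly_Mapping.lookup (v $ j) m) * wedge vs - pgen (Vec v) * contract m j (wedge vs)"
proof -
  let ?\<phi> = "\<lambda>v. Poly_Mapping.lookup (v $ j) m"
  obtain e where e: "wedge vs = toE e"
    by (metis Quotient_abs_rep[OF Quotient_palg])
  have "contract m j (toE (Mul (Gen (Vec v)) e)) = toE (contract_exp ?\<phi> (Mul (Gen (Vec v)) e))"
    by (simp only: contract.abs_eq)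
  moreover have "wedge (v # vs) = pgen (Vec v) * wedge vs"
    by (simp add: wedge_def)
  ultimately show ?thesis
    by (simp add: toE_simps e pconst_minus_one contract.abs_eq)
qed

lift_definition augmentation :: "'g::presentation palg \<Rightarrow> complex" is augment
  by (rule augment_cong)

lemma augmentation_simps:
  "augmentation (a + b) = augmentation a + augmentation b"
  "augmentation (- a) = - augmentation a"
  "augmentation (pscale c a) = c * augmentation a"
  "augmentation 0 = 0" "augmentation 1 = 1"
  unfolding pscale_def by (transfer; simp)+

section \<open>Wedge products up to sign\<close>

text \<open>
  All memberships and nonvanishing statements that follow are insensitive to the sign of a wedge
  product, so signs of permutations are never computed.
\<close>

definition up_to_sign :: "'a::uminus \<Rightarrow> 'a \<Rightarrow> bool" where
  "up_to_sign a b \<longleftrightarrow> a = b \<or> a = - b"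

lemma up_to_sign_trans: "up_to_sign a b \<Longrightarrow> up_to_sign b c \<Longrightarrow> up_to_sign a (c :: 'a::group_add)"
  by (auto simp: up_to_sign_def)

lemma up_to_sign_sym: "up_to_sign a b \<Longrightarrow> up_to_sign b (a :: 'a::group_add)"
  by (auto simp: up_to_sign_def)

lemma up_to_sign_mult: "up_to_sign a b \<Longrightarrow> up_to_sign (c * a) (c * b :: 'a::ring)"
  by (auto simp: up_to_sign_def)

lemma up_to_sign_zero: "up_to_sign a (0 :: 'a::group_add) \<longleftrightarrow> a = 0"
  by (auto simp: up_to_sign_def)

lemma up_to_sign_subspace:
  assumes "up_to_sign a b" "palg.subspace W"
  shows "a \<in> W \<longleftrightarrow> b \<in> W"
  using assms palg.subspace_neg by (metis minus_minus up_to_sign_def)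

lemma wedge_Cons: "wedge (v # vs) = pgen (Vec v) * wedge vs"
  by (simp add: wedge_def)

lemma wedge_slot: "wedge (xs @ v # ys) = wedge xs * (pgen (Vec v) * wedge ys)"
  by (simp add: wedge_def)

lemma wedge_move_front: "up_to_sign (wedge (xs @ v # ys)) (wedge (v # xs @ ys))"
proof (induction xs)
  case (Cons x xs)
  have "up_to_sign (wedge (x # xs @ v # ys)) (pgen (Vec x) * wedge (v # xs @ ys))"
    using up_to_sign_mult[OF Cons] by (simp add: wedge_Cons)
  moreover have "pgen (Vec x) * wedge (v # xs @ ys) = - wedge (v # x # xs @ ys)"
  proof -
    have "pgen (Vec x) * pgen (Vec v) = - (pgen (Vec v) * pgen (Vec x))"
      using vec_anticommute by (metis eq_neg_iff_add_eq_0)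
    thus ?thesis by (simp add: wedge_Cons flip: mult.assoc)
  qed
  ultimately show ?case by (auto simp: up_to_sign_def)
qed (simp add: up_to_sign_def)

lemma wedge_permute: "mset vs = mset ws \<Longrightarrow> up_to_sign (wedge vs) (wedge ws)"
proof (induction vs arbitrary: ws)
  case (Cons v vs)
  have "v \<in> set ws"
    using Cons.prems by (metis list.set_intros(1) mset_eq_setD)
  then obtain xs ys where ws: "ws = xs @ v # ys"
    by (auto dest: split_list)
  with Cons have "up_to_sign (wedge vs) (wedge (xs @ ys))"
    by simp
  hence "up_to_sign (wedge (v # vs)) (wedge (v # xs @ ys))"
    by (simp add: wedge_Cons up_to_sign_mult)
  thus ?case
    unfolding ws using wedge_move_front up_to_sign_sym up_to_sign_trans by blast
qed (simp add: up_to_sign_def)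

lemma wedge_repeated:
  assumes "\<not> distinct vs"
  shows "wedge vs = 0"
proof -
  obtain xs y ys zs where "vs = xs @ [y] @ ys @ [y] @ zs"
    using not_distinct_decomp[OF assms] by blast
  hence "up_to_sign (wedge vs) (wedge (y # y # xs @ ys @ zs))"
    by (intro wedge_permute) simp
  moreover have "wedge (y # y # xs @ ys @ zs) = 0"
    by (simp add: wedge_Cons vec_square flip: mult.assoc)
  ultimately show ?thesis by (simp add: up_to_sign_zero)
qed

section \<open>Wedges of basis vectors\<close>

text \<open>
  The pair \<open>(i, j)\<close> stands for \<open>u\<^sub>j x\<^sup>N\<^sup>-\<^sup>i\<close>; its first component is called
  the depth. Lists are used in place of sets so that the order of the factors is explicit.
\<close>

abbreviation depth_uvec :: "int \<Rightarrow> nat \<times> 'r::finite \<Rightarrow> 'r lvec" where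
  "depth_uvec N h \<equiv> uvec (snd h) (N - int (fst h))"

abbreviation depth_wedge :: "int \<Rightarrow> (nat \<times> 'r::finite) list \<Rightarrow> 'r ext" where
  "depth_wedge N hs \<equiv> wedge (map (depth_uvec N) hs)"

lemma u_set_eq: "u_set enum N H = depth_wedge N (enum H)"
  by (simp add: u_set_def case_prod_unfold)

lemma depth_wedge_permute:
  assumes "distinct hs" "distinct gs" "set hs = set gs"
  shows "up_to_sign (depth_wedge N hs) (depth_wedge N gs)"
proof (rule wedge_permute)
  have "mset hs = mset gs"
    using assms set_eq_iff_mset_eq_distinct by blast
  thus "mset (map (depth_uvec N) hs) = mset (map (depth_uvec N) gs)"
    by simp
qed

lemma depth_wedge_repeated: "\<not> distinct hs \<Longrightarrow> depth_wedge N hs = 0"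
  by (rule wedge_repeated) (simp add: distinct_map)

lemma depth_uvec_in_VN: "1 \<le> fst h \<Longrightarrow> depth_uvec N h \<in> VN N"
  by (auto simp: VN_def uvec_def axis_def xpow_def)

lemma lookup_depth_uvec:
  "Poly_Mapping.lookup (depth_uvec N h $ snd g) (N - int (fst g)) = (if h = g then 1 else 0)"
  by (auto simp: uvec_def axis_def xpow_def lookup_single prod_eq_iff)

definition contract_list :: "int \<Rightarrow> (nat \<times> 'r::finite) list \<Rightarrow> 'r ext \<Rightarrow> 'r ext" where
  "contract_list N gs = fold (\<lambda>g. contract (N - int (fst g)) (snd g)) gs"

lemma contract_zero: "contract m j 0 = 0"
  using contract_plus[of m j 0 0] by simp

lemma contract_neg: "contract m j (- a) = - contract m j a"
  using contract_scale[of m j "- 1" a] by (simp add: pscale_def pconst_minus_one)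

lemma contract_depth_wedge_absent:
  "g \<notin> set hs \<Longrightarrow> contract (N - int (fst g)) (snd g) (depth_wedge N hs) = 0"
proof (induction hs)
  case Nil
  have "(wedge [] :: 'a ext) = toE (Const 1)"
    by (simp add: wedge_def toE_simps pconst_one)
  moreover have "contract m j (toE (Const 1)) = 0" for m and j :: 'a
    using contract.abs_eq[of m j "Const 1"] by (simp add: toE_simps pconst_zero)
  ultimately show ?case by simp
next
  case (Cons h hs)
  thus ?case by (auto simp: contract_wedge_Cons lookup_depth_uvec pconst_zero)
qed

lemma contract_depth_wedge_head:
  "g \<notin> set hs \<Longrightarrow>
    contract (N - int (fst g)) (snd g) (depth_wedge N (g # hs)) = depth_wedge N hs"
  by (simp add: contract_wedge_Cons lookup_depth_uvec pconst_one contract_depth_wedge_absent)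

lemma contract_list_linear:
  "contract_list N gs (a + b) = contract_list N gs a + contract_list N gs b"
  "contract_list N gs (pscale c a) = pscale c (contract_list N gs a)"
  "contract_list N gs 0 = 0"
  "contract_list N gs (- a) = - contract_list N gs a"
  by (induction gs arbitrary: a b)
    (auto simp: contract_list_def contract_plus contract_scale contract_zero contract_neg)

text \<open>
  Up to sign, the factor indexed by the first \<open>g\<close> may be moved to the front, where contraction
  deletes it. If some \<open>g\<close> is missing among the factors, its contraction gives zero; otherwise
  all factors are deleted and the constant \<open>\<plusminus>1\<close> remains.
\<close>

lemma augmentation_contract_list:
  assumes "distinct gs" "distinct hs" "length gs = length hs"
  shows "augmentation (contract_list N gs (depth_wedge N hs)) \<noteq> 0 \<longleftrightarrow> set gs = set hs"
  using assms
proof (induction gs arbitrary: hs)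
  case Nil
  thus ?case by (simp add: contract_list_def wedge_def augmentation_simps)
next
  case (Cons g gs)
  show ?case
  proof (cases "g \<in> set hs")
    case False
    hence "contract_list N (g # gs) (depth_wedge N hs) = contract_list N gs 0"
      by (simp add: contract_list_def contract_depth_wedge_absent)
    moreover have "set (g # gs) \<noteq> set hs"
      using False by auto
    ultimately show ?thesis
      by (simp only: contract_list_linear augmentation_simps) simp
  next
    case True
    then obtain xs ys where hs: "hs = xs @ g # ys"
      by (auto dest: split_list)
    let ?w = "depth_wedge N (g # xs @ ys)"
    have g: "g \<notin> set (xs @ ys)" and d: "distinct (xs @ ys)"
      using Cons.prems hs by auto
    have "up_to_sign (depth_wedge N hs) ?w"
      unfolding hs by (simp add: wedge_move_front)
    hence "augmentation (contract_list N (g # gs) (depth_wedge N hs)) \<noteq> 0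
        \<longleftrightarrow> augmentation (contract_list N (g # gs) ?w) \<noteq> 0"
      unfolding up_to_sign_def
      by (elim disjE)
        (simp_all only: contract_list_linear augmentation_simps neg_equal_0_iff_equal)
    also have "contract_list N (g # gs) ?w = contract_list N gs (depth_wedge N (xs @ ys))"
      using contract_depth_wedge_head[OF g, of N] by (simp add: contract_list_def)
    also have "augmentation \<dots> \<noteq> 0 \<longleftrightarrow> set gs = set (xs @ ys)"
      using Cons.prems d hs by (intro Cons.IH) auto
    also have "\<dots> \<longleftrightarrow> set (g # gs) = set hs"
      using Cons.prems g hs insert_ident[of g "set gs" "set (xs @ ys)"] by simp
    finally show ?thesis .
  qed
qed

text \<open>
  The functionals \<open>L G\<close>, obtained by contracting with all of \<open>G\<close>, separate the wedges: a
  family with such a biorthogonal system is injective and independent. Equal cardinality is what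
  excludes proper inclusions between distinct index sets.
\<close>

lemma depth_wedges_independent:
  fixes F :: "(nat \<times> 'r::finite) set set"
  assumes enum: "\<And>H. finite H \<Longrightarrow> distinct (enum H) \<and> set (enum H) = H"
    and F: "\<And>H. H \<in> F \<Longrightarrow> finite H \<and> card H = n"
  shows "inj_on (u_set enum N) F" "palg.independent (u_set enum N ` F)"
proof -
  define L where "L H w = augmentation (contract_list N (enum H) w)" for H and w :: "'r ext"
  have dual: "L G (u_set enum N H) \<noteq> 0 \<longleftrightarrow> G = H"
    if "G \<in> F" "H \<in> F" for G H
  proof -
    have "distinct (enum G)" "distinct (enum H)" "set (enum G) = G" "set (enum H) = H"
      using enum F that by blast+
    moreover from this have "length (enum G) = length (enum H)"
      using F that by (metis distinct_card)
    ultimately show ?thesis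
      using augmentation_contract_list[of "enum G" "enum H" N] by (simp add: L_def u_set_eq)
  qed
  show "inj_on (u_set enum N) F"
  proof (rule inj_onI)
    fix G H assume "G \<in> F" "H \<in> F" "u_set enum N G = u_set enum N H"
    thus "G = H"
      using dual[of G G] dual[of G H] by simp
  qed
  show "palg.independent (u_set enum N ` F)"
    unfolding palg.dependent_def
  proof safe
    fix G assume G: "G \<in> F"
    assume "u_set enum N G \<in> palg.span (u_set enum N ` F - {u_set enum N G})"
    hence "L G (u_set enum N G) = 0"
    proof (induction rule: palg.span_induct_alt)
      case base
      show ?case by (simp add: L_def contract_list_linear augmentation_simps)
    next
      case (step c x y)
      then obtain H where "x = u_set enum N H" "H \<in> F" "H \<noteq> G"
        by auto
      with step dual[of G H] G show ?case
        by (simp add: L_def contract_list_linear augmentation_simps)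
    qed
    with dual[OF G G] show False by simp
  qed
qed

section \<open>The submodule spanned by the dominating sets\<close>

text \<open>
  Each \<open>x\<^sup>m \<complex>[x]\<close> is stable under the algebra. This is the reason why no depth ever
  increases.
\<close>

lemma keys_weyl_act:
  assumes "Poly_Mapping.keys f \<subseteq> {m..}"
  shows "Poly_Mapping.keys (weyl_act w f) \<subseteq> {m..}"
  using below_weyl_act[of m w f] assms unfolding below_eq_0_iff[symmetric]
  by (simp add: weyl_act_zero below_zero)

lemma keys_VN_act_depth_uvec:
  "Poly_Mapping.keys (VN_act N A (depth_uvec N h) $ j) \<subseteq> {N - int (fst h)..<N}"
proof -
  let ?m = "N - int (fst h)"
  have "Poly_Mapping.keys (depth_uvec N h $ k) \<subseteq> {?m..}" for k
    by (auto simp: uvec_def axis_def xpow_def)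
  hence "below ?m (weyl_act (A $ j $ k) (depth_uvec N h $ k)) = 0" for k
    unfolding below_eq_0_iff by (rule keys_weyl_act)
  moreover have "below ?m (below N f) = below ?m f" for f
    by (rule poly_mapping_eqI) (simp add: lookup_below)
  ultimately have "below ?m (VN_act N A (depth_uvec N h) $ j) = 0"
    by (simp add: VN_act_def vbelow_def gl_act_def below_sum)
  hence "Poly_Mapping.keys (VN_act N A (depth_uvec N h) $ j) \<subseteq> {?m..}"
    by (simp add: below_eq_0_iff)
  moreover have "Poly_Mapping.keys (VN_act N A (depth_uvec N h) $ j) \<subseteq> {..<N}"
    using VN_act_in_VN[of N A "depth_uvec N h"] by (simp add: VN_def)
  ultimately show ?thesis by auto
qed

lemma lvec_expand:
  fixes v :: "'r::finite lvec"
  assumes "finite I" "\<And>j. Poly_Mapping.keys (v $ j) \<subseteq> I"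
  shows "v = (\<Sum>j\<in>UNIV. \<Sum>i\<in>I. lconst (Poly_Mapping.lookup (v $ j) i) *s uvec j i)"
proof (unfold vec_eq_iff, intro allI poly_mapping_eqI)
  fix k m
  have "Poly_Mapping.lookup (\<Sum>i\<in>I. lconst (Poly_Mapping.lookup (v $ k) i) * xpow i) m
      = (\<Sum>i\<in>I. if i = m then Poly_Mapping.lookup (v $ k) i else 0)"
    unfolding lookup_sum
    by (intro sum.cong) (auto simp: lconst_def xpow_def mult_single lookup_single)
  also have "\<dots> = Poly_Mapping.lookup (v $ k) m"
    using assms(1) assms(2)[of k] by (auto simp: sum.delta in_keys_iff)
  finally show "Poly_Mapping.lookup (v $ k) m = Poly_Mapping.lookup
      ((\<Sum>j\<in>UNIV. \<Sum>i\<in>I. lconst (Poly_Mapping.lookup (v $ j) i) *s uvec j i) $ k) m"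
    by (subst sum.swap) (simp add: uvec_def axis_def if_distrib sum.delta' cong: if_cong)
qed

lemma vec_zero: "pgen (Vec 0) = (0 :: 'r::finite ext)"
  using vec_plus[of 0 0] by simp

lemma vec_sum: "pgen (Vec (\<Sum>i\<in>I. f i)) = (\<Sum>i\<in>I. pgen (Vec (f i)) :: 'r::finite ext)"
  by (induction I rule: infinite_finite_induct) (auto simp: vec_zero vec_plus)

text \<open>
  By multilinearity, membership of a wedge in a subspace may be tested with one factor replaced by
  the basis vectors that occur in it.
\<close>

lemma wedge_slot_subspace:
  fixes v :: "'r::finite lvec"
  assumes W: "palg.subspace W"
    and I: "finite I" "\<And>j. Poly_Mapping.keys (v $ j) \<subseteq> I"
    and basis: "\<And>j i. i \<in> I \<Longrightarrow> wedge (xs @ uvec j i # ys) \<in> W"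
  shows "wedge (xs @ v # ys) \<in> W"
proof -
  have "wedge (xs @ v # ys) = (\<Sum>j\<in>UNIV. \<Sum>i\<in>I.
      pscale (Poly_Mapping.lookup (v $ j) i) (wedge (xs @ uvec j i # ys)))"
    unfolding wedge_slot
    by (subst lvec_expand[OF I])
      (simp add: vec_sum vec_scale sum_distrib_left sum_distrib_right pscale_def mult.assoc
        pconst_mult_left_commute)
  thus ?thesis
    using basis by (auto intro!: palg.subspace_sum[OF W] palg.subspace_scale[OF W])
qed

definition depth_count :: "nat \<Rightarrow> (nat \<times> 'r) set \<Rightarrow> nat" where
  "depth_count k H = card {h \<in> H. fst h \<le> k}"

text \<open>
  The sets of the same size as \<open>D\<close> that are, level by level, at least as shallow. For
  \<open>D\<close> the Young diagram of \<open>\<xi>\<close> these are the admissible sets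
  (\<open>admissible_eq_dominating\<close>); a general \<open>D\<close> is needed because the starting set
  varies in the induction of \<open>submodule_dominating\<close>.
\<close>

definition dominating :: "(nat \<times> 'r) set \<Rightarrow> (nat \<times> 'r) set set" where
  "dominating D = {H. finite H \<and> H \<subseteq> {1..} \<times> UNIV \<and> card H = card D
    \<and> (\<forall>k. depth_count k D \<le> depth_count k H)}"

text \<open>
  The count of the exchanged set is stated additively because natural subtraction truncates. The
  hypothesis on \<open>y\<close> admits the trivial exchange \<open>y = x\<close>, which occurs when an operator
  acts diagonally.
\<close>

lemma depth_count_exchange:
  assumes "finite H" "x \<in> H" "y \<notin> H - {x}"
  shows "depth_count k (insert y (H - {x})) + of_bool (fst x \<le> k)
    = depth_count k H + of_bool (fst y \<le> k)"
proof -
  have *: "depth_count k G = (\<Sum>h\<in>G. of_bool (fst h \<le> k))" if "finite G" for G :: "(nat \<times> 'a) set"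
    using that by (simp add: depth_count_def sum_of_bool_eq Int_def)
  show ?thesis
    using assms by (simp add: * sum.remove[of H x] del: sum_of_bool_eq)
qed

lemma card_exchange:
  "finite H \<Longrightarrow> x \<in> H \<Longrightarrow> y \<notin> H - {x} \<Longrightarrow> card (insert y (H - {x})) = card H"
  using card_Suc_Diff1[of H x] by (simp del: card_Diff_singleton)

lemma dominating_exchange:
  assumes "H \<in> dominating D" "x \<in> H" "y \<notin> H - {x}" "1 \<le> fst y" "fst y \<le> fst x"
  shows "insert y (H - {x}) \<in> dominating D"
proof -
  have "depth_count k D \<le> depth_count k (insert y (H - {x}))" for k
  proof -
    have "(of_bool (fst x \<le> k) :: nat) \<le> of_bool (fst y \<le> k)"
      using assms by auto
    moreover have "finite H" "depth_count k D \<le> depth_count k H"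
      using assms by (simp_all add: dominating_def)
    ultimately show ?thesis
      using depth_count_exchange[of H x y k] assms by linarith
  qed
  with assms show ?thesis
    using card_exchange[of H x y] by (auto simp: dominating_def mem_Times_iff)
qed

text \<open>
  Acting on a wedge replaces one factor \<open>h\<close> at a time by a combination of basis vectors of
  depth at most that of \<open>h\<close>. Each resulting wedge either has a repeated factor and vanishes, or
  comes from an exchange, which preserves domination.
\<close>

lemma span_dominating_submodule:
  fixes D :: "(nat \<times> 'r::finite) set"
  assumes enum: "\<And>H. finite H \<Longrightarrow> distinct (enum H) \<and> set (enum H) = H"
  shows "is_submodule N (card D) (palg.span (u_set enum N ` dominating D))"
proof -
  let ?W = "palg.span (u_set enum N ` dominating D)"
  have W: "palg.subspace ?W"
    by (rule palg.subspace_span)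
  have moved: "depth_wedge N (hs[i := y]) \<in> ?W"
    if H: "H \<in> dominating D" and hs: "distinct hs" "set hs = H" and i: "i < length hs"
      and y: "1 \<le> fst y" "fst y \<le> fst (hs ! i)" for H hs i y
  proof (cases "y \<in> H - {hs ! i}")
    case True
    have "set (hs[i := y]) = insert y (H - {hs ! i})"
      using hs i by (simp add: set_update_distinct)
    also have "\<dots> = H - {hs ! i}"
      using True by auto
    finally have "card (set (hs[i := y])) < card H"
      using hs i by (metis List.finite_set card_Diff1_less nth_mem)
    moreover have "card H = length (hs[i := y])"
      using hs distinct_card[of hs] by simp
    ultimately have "\<not> distinct (hs[i := y])"
      using distinct_card[of "hs[i := y]"] by linarith
    thus ?thesis by (simp add: depth_wedge_repeated palg.span_zero)
  next
    case False
    let ?H = "insert y (H - {hs ! i})"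
    have "?H \<in> dominating D"
      using H hs i y False by (intro dominating_exchange) auto
    hence fin: "finite ?H" and "u_set enum N ?H \<in> ?W"
      by (simp add: dominating_def, blast intro: palg.span_base)
    moreover have "up_to_sign (depth_wedge N (hs[i := y])) (u_set enum N ?H)"
      unfolding u_set_eq
    proof (rule depth_wedge_permute)
      show "distinct (hs[i := y])"
        using hs i False by (simp add: distinct_list_update)
      show "distinct (enum ?H)"
        using enum[OF fin] by blast
      show "set (hs[i := y]) = set (enum ?H)"
        using enum[OF fin] hs i by (simp only: set_update_distinct)
    qed
    ultimately show ?thesis
      using up_to_sign_subspace[OF _ W] by blast
  qed
  have act: "ext_act N A (u_set enum N H) \<in> ?W" if H: "H \<in> dominating D" for A H
  proof -
    define hs where "hs = enum H"
    have hs: "distinct hs" "set hs = H"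
      using enum[of H] H by (simp_all add: hs_def dominating_def)
    let ?vs = "map (depth_uvec N) hs"
    have "wedge (?vs[i := VN_act N A (?vs ! i)]) \<in> ?W" if i: "i < length hs" for i
    proof -
      have "wedge (take i ?vs @ VN_act N A (depth_uvec N (hs ! i)) # drop (Suc i) ?vs) \<in> ?W"
      proof (rule wedge_slot_subspace[OF W _ keys_VN_act_depth_uvec])
        fix j :: 'r and m assume m: "m \<in> {N - int (fst (hs ! i))..<N}"
        let ?y = "(nat (N - m), j)"
        have "wedge (take i ?vs @ uvec j m # drop (Suc i) ?vs) = depth_wedge N (hs[i := ?y])"
          using i m by (simp add: map_update upd_conv_take_nth_drop take_map drop_map)
        also have "\<dots> \<in> ?W"
          using m by (intro moved[OF H hs i]) auto
        finally show "wedge (take i ?vs @ uvec j m # drop (Suc i) ?vs) \<in> ?W" .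
      qed simp
      thus ?thesis
        using i by (simp add: upd_conv_take_nth_drop)
    qed
    moreover have "u_set enum N H = wedge ?vs"
      by (simp add: hs_def u_set_eq)
    ultimately show ?thesis
      by (auto simp: ext_act_wedge intro!: palg.subspace_sum[OF W])
  qed
  have "ext_act N A w \<in> ?W" if "w \<in> ?W" for A w
    using that
  proof (induction rule: palg.span_induct_alt)
    case base
    show ?case
      using ext_act_const[of N A 0] by (simp add: pconst_zero palg.span_zero)
  next
    case (step c x y)
    then obtain H where "x = u_set enum N H" "H \<in> dominating D"
      by blast
    hence "ext_act N A x \<in> ?W"
      by (simp add: act)
    thus ?case
      using step by (simp add: ext_act_plus ext_act_scale palg.span_add palg.span_scale)
  qed
  moreover have "?W \<subseteq> ext_power N (card D)"
  proof (rule palg.span_minimal)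
    show "u_set enum N ` dominating D \<subseteq> ext_power N (card D)"
    proof safe
      fix H assume H: "H \<in> dominating D"
      hence "distinct (enum H)" "set (enum H) = H"
        using enum[of H] by (simp_all add: dominating_def)
      moreover from this have "length (enum H) = card D"
        using H distinct_card[of "enum H"] by (simp add: dominating_def)
      ultimately have "length (map (depth_uvec N) (enum H)) = card D"
        "set (map (depth_uvec N) (enum H)) \<subseteq> VN N"
        using H by (auto simp: dominating_def intro!: depth_uvec_in_VN)
      thus "u_set enum N H \<in> ext_power N (card D)"
        unfolding ext_power_def u_set_eq by (intro palg.span_base) blast
    qed
    show "palg.subspace (ext_power N (card D))"
      using ext_power_submodule by (auto simp: is_submodule_def)
  qed
  ultimately show ?thesis
    using W by (simp add: is_submodule_def)
qed

section \<open>Elementary moves reach every dominating set\<close>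

lemma lconst_diff: "lconst (x - y) = lconst x - lconst y"
  by (simp add: lconst_def single_diff)

text \<open>
  The element \<open>w\<close> is the Lagrange interpolation polynomial in \<open>\<Y>\<close>, built one root at a
  time.
\<close>

lemma weyl_interpolation:
  "finite M \<Longrightarrow> k \<notin> M \<Longrightarrow>
    \<exists>w. weyl_act w (xpow k) = xpow k \<and> (\<forall>m\<in>M. weyl_act w (xpow m) = 0)"
proof (induction M rule: finite_induct)
  case empty
  show ?case
    using weyl_act_const[of 1] by (auto simp: lconst_simps intro!: exI[of _ "pconst 1"])
next
  case (insert m M)
  then obtain w where w: "weyl_act w (xpow k) = xpow k" "\<forall>m\<in>M. weyl_act w (xpow m) = 0"
    by auto
  \<comment> \<open>The linear polynomial in \<open>\<Y>\<close> with value 1 at \<open>k\<close> and root \<open>m\<close>.\<close>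
  define q :: weyl where
    "q = pconst (1 / of_int (k - m)) * (pgen GenY - pconst (of_int m))"
  have q: "weyl_act q (xpow i) = lconst (of_int (i - m) / of_int (k - m)) * xpow i" for i
  proof -
    have "lconst (of_int (i - m) / of_int (k - m))
        = lconst (1 / of_int (k - m)) * (lconst (of_int i) - lconst (of_int m))"
      by (simp add: lconst_simps(2)[symmetric] lconst_diff[symmetric])
    moreover have "euler (xpow i) = lconst (of_int i) * xpow i"
      by (simp only: xpow_def euler_single lconst_def mult_single) simp
    ultimately show ?thesis
      by (simp only: q_def weyl_act_times weyl_act_minus weyl_act_Y weyl_act_const mult.assoc
          left_diff_distrib)
  qed
  have "k \<noteq> m"
    using insert.prems by auto
  \<comment> \<open>The factor \<open>q\<close> acts first: \<open>w\<close> is unknown at \<open>m\<close>, but \<open>q\<close> already kills \<open>x\<^sup>m\<close>.\<close>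
  hence "weyl_act (w * q) (xpow k) = xpow k"
    by (simp add: weyl_act_times q w lconst_simps del: of_int_diff)
  moreover have "weyl_act (w * q) (xpow i) = 0" if "i \<in> insert m M" for i
    using that w by (auto simp: weyl_act_times q weyl_act_scale weyl_act_zero lconst_simps)
  ultimately show ?case by blast
qed

lemma weyl_act_X_power: "weyl_act (pgen GenX ^ n) (xpow k) = xpow (k + int n)"
proof (induction n)
  case 0
  show ?case
    using weyl_act_const[of 1] by (simp add: pconst_one lconst_simps)
next
  case (Suc n)
  thus ?case
    by (simp add: weyl_act_times weyl_act_X) (simp add: xpow_def mult_single add_ac)
qed

lemma gl_act_uvec: "gl_act A (uvec j m) $ i = weyl_act (A $ i $ j) (xpow m)"
proof -
  have "(\<Sum>k\<in>UNIV. weyl_act (A $ i $ k) (uvec j m $ k))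
      = (\<Sum>k\<in>UNIV. if k = j then weyl_act (A $ i $ j) (xpow m) else 0)"
    by (intro sum.cong) (auto simp: uvec_def axis_def weyl_act_zero)
  thus ?thesis
    by (simp add: gl_act_def)
qed

lemma VN_act_single_entry:
  "VN_act N (\<chi> a' b'. if a' = a \<and> b' = b then w else 0) (uvec j m)
    = (if j = b then axis a (below N (weyl_act w (xpow m))) else 0)"
  by (auto simp: vec_eq_iff VN_act_def vbelow_def gl_act_uvec axis_def below_zero weyl_act_zero_left)

text \<open>
  Interpolation kills the elements of \<open>S\<close> that share the second component of \<open>x\<close>,
  since their depths differ from that of \<open>x\<close>; the position of the matrix entry kills the
  others; and the power of \<open>\<X>\<close> moves \<open>x\<close> to the depth of \<open>y\<close>.
\<close>

lemma elementary_move: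
  fixes x y :: "nat \<times> 'r::finite"
  assumes "finite S" "x \<notin> S" "1 \<le> fst y" "fst y \<le> fst x"
  obtains A where "VN_act N A (depth_uvec N x) = depth_uvec N y"
    "\<And>h. h \<in> S \<Longrightarrow> VN_act N A (depth_uvec N h) = 0"
proof -
  let ?k = "N - int (fst x)"
  let ?M = "(\<lambda>h. N - int (fst h)) ` S - {?k}"
  obtain w where w: "weyl_act w (xpow ?k) = xpow ?k" "\<forall>m\<in>?M. weyl_act w (xpow m) = 0"
    using weyl_interpolation[of ?M ?k] assms by auto
  define A :: "'r gl_weyl" where "A = (\<chi> a b. if a = snd y \<and> b = snd x
    then pgen GenX ^ (fst x - fst y) * w else 0)"
  show ?thesis
  proof
    have "below N (xpow (N - int (fst y))) = xpow (N - int (fst y))"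
      using assms by (simp add: xpow_def below_single)
    thus "VN_act N A (depth_uvec N x) = depth_uvec N y"
      using assms unfolding A_def VN_act_single_entry
      by (simp add: weyl_act_times w weyl_act_X_power uvec_def of_nat_diff)
    fix h assume h: "h \<in> S"
    show "VN_act N A (depth_uvec N h) = 0"
    proof (cases "snd h = snd x")
      case True
      hence "fst h \<noteq> fst x"
        using assms h by (metis prod_eqI)
      hence "N - int (fst h) \<in> ?M"
        using h by auto
      thus ?thesis
        using w unfolding A_def VN_act_single_entry
        by (simp add: weyl_act_times weyl_act_zero below_zero vec_eq_iff axis_def)
    qed (simp add: A_def VN_act_single_entry)
  qed
qed

lemma ext_act_wedge_zero:
  "(\<And>v. v \<in> set vs \<Longrightarrow> VN_act N A v = 0) \<Longrightarrow> ext_act N A (wedge vs) = 0"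
proof (induction vs)
  case Nil
  show ?case
    using ext_act_const[of N A 1] by (simp add: wedge_def pconst_one)
qed (simp add: wedge_Cons ext_act_times ext_act_vec vec_zero)

lemma submodule_move:
  assumes W: "is_submodule N n W" and "depth_wedge N (x # hs) \<in> W"
    and xy: "x \<notin> set hs" "1 \<le> fst y" "fst y \<le> fst x"
  shows "depth_wedge N (y # hs) \<in> W"
proof -
  obtain A where A: "VN_act N A (depth_uvec N x) = depth_uvec N y"
    "\<And>h. h \<in> set hs \<Longrightarrow> VN_act N A (depth_uvec N h) = 0"
    using elementary_move[of "set hs" x y N] xy by blast
  hence "ext_act N A (depth_wedge N hs) = 0"
    by (intro ext_act_wedge_zero) auto
  hence "ext_act N A (depth_wedge N (x # hs)) = depth_wedge N (y # hs)"
    by (simp add: wedge_Cons ext_act_times ext_act_vec A)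
  moreover have "ext_act N A (depth_wedge N (x # hs)) \<in> W"
    using W \<open>depth_wedge N (x # hs) \<in> W\<close> unfolding is_submodule_def by blast
  ultimately show ?thesis by (simp only:)
qed

text \<open>
  Induction on \<open>card (S - H)\<close>. The choice of \<open>x\<close> and \<open>y\<close> as shallowest elements of
  \<open>S - H\<close> and \<open>H - S\<close> serves both to make the move permitted and to keep the exchanged
  set dominated by \<open>H\<close>.
\<close>

lemma submodule_dominating:
  fixes S :: "(nat \<times> 'r::finite) set"
  assumes enum: "\<And>H. finite H \<Longrightarrow> distinct (enum H) \<and> set (enum H) = H"
    and W: "is_submodule N n W"
  shows "finite S \<Longrightarrow> u_set enum N S \<in> W \<Longrightarrow> H \<in> dominating S \<Longrightarrow> u_set enum N H \<in> W"
proof (induction "card (S - H)" arbitrary: S rule: less_induct)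
  case less
  have H: "finite H" "H \<subseteq> {1..} \<times> UNIV" "card H = card S"
    "\<And>k. depth_count k S \<le> depth_count k H"
    using less.prems by (auto simp: dominating_def)
  note fin = \<open>finite S\<close> \<open>finite H\<close>
  show ?case
  proof (cases "S = H")
    case True
    with less.prems show ?thesis by simp
  next
    case False
    have "S - H \<noteq> {}" "H - S \<noteq> {}"
      using False fin H(3) by (metis Diff_eq_empty_iff card_subset_eq)+
    then obtain x y
      where x: "x \<in> S - H" "\<And>z. z \<in> S - H \<Longrightarrow> fst x \<le> fst z"
        and y: "y \<in> H - S" "\<And>z. z \<in> H - S \<Longrightarrow> fst y \<le> fst z"
      using ex_has_least_nat[of "\<lambda>z. z \<in> S - H" _ fst] ex_has_least_nat[of "\<lambda>z. z \<in> H - S" _ fst]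
      by (metis ex_in_conv)
    \<comment> \<open>If \<open>y\<close> were deeper, then up to the depth of \<open>x\<close> all of \<open>H\<close> would lie in \<open>S\<close>, with \<open>x\<close> missing.\<close>
    have xy: "fst y \<le> fst x"
    proof (rule ccontr)
      assume "\<not> fst y \<le> fst x"
      hence "z \<in> S" if "z \<in> H" "fst z \<le> fst x" for z
        using y(2)[of z] that by (meson DiffI order_trans)
      hence "{h \<in> H. fst h \<le> fst x} \<subset> {h \<in> S. fst h \<le> fst x}"
        using x(1) by blast
      hence "depth_count (fst x) H < depth_count (fst x) S"
        unfolding depth_count_def using fin by (intro psubset_card_mono) auto
      with H(4)[of "fst x"] show False by simp
    qed
    let ?S = "insert y (S - {x})"
    have "depth_count k ?S \<le> depth_count k H" for k
    \<comment> \<open>Only for these \<open>k\<close> does the count of \<open>S\<close> grow. There \<open>S\<close> is contained in \<open>H\<close> up to depth \<open>k\<close> and misses \<open>y\<close>, so there was room for one more element.\<close>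
    proof (cases "fst y \<le> k \<and> k < fst x")
      case True
      hence "z \<in> H" if "z \<in> S" "fst z \<le> k" for z
        using x(2)[of z] that by (meson DiffI leD le_less_trans)
      hence "{h \<in> S. fst h \<le> k} \<subset> {h \<in> H. fst h \<le> k}"
        using y(1) True by blast
      hence "depth_count k S < depth_count k H"
        unfolding depth_count_def using fin by (intro psubset_card_mono) auto
      thus ?thesis
        using depth_count_exchange[of S x y k] fin x(1) y(1) True by simp
    next
      case False
      thus ?thesis
        using depth_count_exchange[of S x y k] fin x(1) y(1) xy H(4)[of k]
        by (cases "fst y \<le> k"; cases "fst x \<le> k") auto
    qed
    hence "H \<in> dominating ?S"
      using H x(1) y(1) fin card_exchange[of S x y] by (simp add: dominating_def)
    moreover have "?S - H = (S - H) - {x}"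
      using y(1) by auto
    hence "card (?S - H) < card (S - H)"
      using fin x(1) by (metis card_Diff1_less finite_Diff)
    moreover have "u_set enum N ?S \<in> W"
    proof -
      let ?hs = "enum (S - {x})"
      have hs: "distinct ?hs" "set ?hs = S - {x}" "distinct (enum S)" "set (enum S) = S"
        "distinct (enum ?S)" "set (enum ?S) = ?S"
        using enum fin by (metis finite.insertI finite_Diff)+
      have sub: "palg.subspace W"
        using W by (simp add: is_submodule_def)
      have "up_to_sign (u_set enum N S) (depth_wedge N (x # ?hs))"
        unfolding u_set_eq using hs x(1) by (intro depth_wedge_permute) auto
      hence "depth_wedge N (x # ?hs) \<in> W"
        using up_to_sign_subspace[OF _ sub] less.prems(2) by blast
      moreover have "x \<notin> set ?hs" "1 \<le> fst y"
        using hs(2) H(2) y(1) by auto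
      ultimately have "depth_wedge N (y # ?hs) \<in> W"
        using submodule_move[OF W _ _ _ xy] by blast
      moreover have "up_to_sign (u_set enum N ?S) (depth_wedge N (y # ?hs))"
        unfolding u_set_eq using hs y(1) by (intro depth_wedge_permute) auto
      ultimately show ?thesis
        using up_to_sign_subspace[OF _ sub] by blast
    qed
    ultimately show ?thesis
      using less.hyps[of ?S] fin by simp
  qed
qed

section \<open>The Young diagram and the basis\<close>

definition young_diagram :: "('r::finite \<Rightarrow> nat) \<Rightarrow> (nat \<times> 'r) set" where
  "young_diagram \<xi> = {(i, j). 1 \<le> i \<and> i \<le> \<xi> j}"

lemma young_diagram_columns: "young_diagram \<xi> = prod.swap ` (SIGMA j:UNIV. {1..\<xi> j})"
  by (force simp: young_diagram_def)

lemma finite_young_diagram: "finite (young_diagram \<xi>)"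
  unfolding young_diagram_columns by simp

lemma card_young_diagram: "card (young_diagram \<xi>) = partition_size \<xi>"
  unfolding young_diagram_columns partition_size_def
  by (subst card_image) (auto intro: inj_on_subset[OF inj_swap])

lemma depth_count_young_diagram:
  "depth_count k (young_diagram \<xi>) = (\<Sum>i=1..k. transposed \<xi> i)"
proof -
  have "{h \<in> young_diagram \<xi>. fst h \<le> k} = (SIGMA i:{1..k}. {j. i \<le> \<xi> j})"
    by (auto simp: young_diagram_def)
  thus ?thesis
    by (simp add: depth_count_def transposed_def)
qed

text \<open>
  The bound for \<open>k = 0\<close> is vacuous, since the Young diagram has no element of depth 0.
\<close>

lemma admissible_eq_dominating: "admissible \<xi> = dominating (young_diagram \<xi>)"
proof -
  have "H \<inter> ({1..k} \<times> UNIV) = {h \<in> H. fst h \<le> k}" if "H \<subseteq> {1..} \<times> UNIV"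
    for H :: "(nat \<times> 'a) set" and k
    using that by auto
  moreover have "(\<forall>k\<ge>1. P k) \<longleftrightarrow> (\<forall>k. P k)" if "P 0" for P :: "nat \<Rightarrow> bool"
    using that by (metis One_nat_def Suc_leI gr0I)
  hence "(\<forall>k\<ge>1. (\<Sum>i=1..k. transposed \<xi> i) \<le> f k) \<longleftrightarrow> (\<forall>k. (\<Sum>i=1..k. transposed \<xi> i) \<le> f k)" for f
    by simp
  ultimately show ?thesis
    unfolding admissible_def dominating_def depth_count_young_diagram card_young_diagram
    by (auto simp: depth_count_def)
qed

lemma v_part_up_to_sign:
  assumes enum: "\<And>H. finite H \<Longrightarrow> distinct (enum H) \<and> set (enum H) = H"
  shows "up_to_sign (v_part \<xi> N) (u_set enum N (young_diagram \<xi>))"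
proof -
  define hs where "hs =
    concat (map (\<lambda>j. map (\<lambda>m. (nat (N - m), j)) [N - int (\<xi> j)..N - 1]) (sorted_list_of_set UNIV))"
  have "v_part \<xi> N = depth_wedge N hs"
    by (auto simp: v_part_def hs_def map_concat intro!: arg_cong[where f = wedge]
        arg_cong[where f = concat])
  moreover have set: "set hs = young_diagram \<xi>"
  proof -
    have "(i, j) \<in> (\<lambda>m. (nat (N - m), j)) ` {N - int (\<xi> j)..N - 1}" if "1 \<le> i" "i \<le> \<xi> j" for i j
      using that by (intro image_eqI[of _ _ "N - int i"]) auto
    thus ?thesis
      by (fastforce simp: hs_def young_diagram_def)
  qed
  moreover have "length hs = card (young_diagram \<xi>)"
    by (simp add: hs_def length_concat comp_def card_young_diagram partition_size_def
        sum_list_distinct_conv_sum_set)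
  hence "distinct hs"
    using set by (metis card_distinct)
  ultimately show ?thesis
    using enum[OF finite_young_diagram] by (auto simp: u_set_eq intro!: depth_wedge_permute)
qed

theorem proposition4:
  fixes \<xi> :: "'r::{finite,linorder} \<Rightarrow> nat" and N :: int
    and enum :: "(nat \<times> 'r) set \<Rightarrow> (nat \<times> 'r) list"
  assumes partition: "antimono \<xi>"
    and enum: "\<And>H. finite H \<Longrightarrow> distinct (enum H) \<and> set (enum H) = H"
  shows "inj_on (u_set enum N) (admissible \<xi>)
    \<and> palg.independent (u_set enum N ` admissible \<xi>)
    \<and> palg.span (u_set enum N ` admissible \<xi>) = V_mod \<xi> N"
proof (intro conjI)
  let ?D = "young_diagram \<xi>"
  let ?B = "u_set enum N ` dominating ?D"
  have F: "finite H \<and> card H = card ?D" if "H \<in> dominating ?D" for H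
    using that by (simp add: dominating_def)
  show "inj_on (u_set enum N) (admissible \<xi>)" "palg.independent (u_set enum N ` admissible \<xi>)"
    unfolding admissible_eq_dominating using depth_wedges_independent[OF enum F] by blast+
  have v: "v_part \<xi> N \<in> W \<longleftrightarrow> u_set enum N ?D \<in> W" if "palg.subspace W" for W
    using up_to_sign_subspace[OF v_part_up_to_sign[OF enum] that] .
  have "palg.span ?B = V_mod \<xi> N"
  proof
    have "?D \<in> dominating ?D"
      by (auto simp: dominating_def finite_young_diagram) (auto simp: young_diagram_def)
    hence "v_part \<xi> N \<in> palg.span ?B"
      by (simp add: v palg.subspace_span palg.span_base)
    thus "V_mod \<xi> N \<subseteq> palg.span ?B"
      using span_dominating_submodule[OF enum, of N ?D]
      unfolding V_mod_def card_young_diagram by blast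
    show "palg.span ?B \<subseteq> V_mod \<xi> N"
      unfolding V_mod_def
    proof safe
      fix W w
      assume W: "is_submodule N (partition_size \<xi>) W" "v_part \<xi> N \<in> W" and w: "w \<in> palg.span ?B"
      hence sub: "palg.subspace W"
        by (simp add: is_submodule_def)
      have "?B \<subseteq> W"
        using submodule_dominating[OF enum W(1) finite_young_diagram] W(2) v[OF sub] by blast
      thus "w \<in> W"
        using w palg.span_minimal[OF _ sub] by blast
    qed
  qed
  thus "palg.span (u_set enum N ` admissible \<xi>) = V_mod \<xi> N"
    by (simp only: admissible_eq_dominating)
qed

end
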